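(* For every natural number $n \geq 3$, the sunlet graph $S_n$ satisfies $\gamma_b(S_n) = \left\lceil \frac{n+1}{2} \right\rceil$.
   Context: The sunlet graph $S_n$ is obtained from the cycle $C_n$ (vertices $v_1,\dots,v_n$, edges $v_iv_{i+1}$ and $v_nv_1$) by attaching to each cycle vertex $v_i$ one new vertex $w_i$ via a pendant edge $v_iw_i$. For a finite graph $G$ with shortest-path distance $d$, a dominating broadcast function is a function $f: V(G) \to \{0,1,2,\dots\}$ such that every vertex $u$ of $G$ satisfies $d(u,v) \leq f(v)$ for at least one vertex $v$ with $f(v) \geq 1$. The cost of $f$ is $\sum_{v \in V(G)} f(v)$, and $\gamma_b(G)$ is the minimum cost of a dominating broadcast function of $G$. *)

theory Defs
  imports "Graph_Theory.Graph_Theory"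
begin

context graph
begin

text \<open>
  With all arc weights equal to 1, \<open>\<mu>\<close> is the shortest-path distance
  (\<open>\<infinity>\<close> between different components). Only the values of a broadcast on
  \<open>verts G\<close> matter.
\<close>

definition dominating_broadcast :: "('a \<Rightarrow> nat) \<Rightarrow> bool" where
  "dominating_broadcast f \<longleftrightarrow>
     (\<forall>u\<in>verts G. \<exists>v\<in>verts G. f v \<ge> 1 \<and> \<mu> (\<lambda>_. 1) u v \<le> ereal (real (f v)))"

definition broadcast_cost :: "('a \<Rightarrow> nat) \<Rightarrow> nat" where
  "broadcast_cost f = (\<Sum>v\<in>verts G. f v)"

definition broadcast_number :: nat where
  "broadcast_number = (LEAST k. \<exists>f. dominating_broadcast f \<and> broadcast_cost f = k)"

lemma dominating_broadcast_const_1: "dominating_broadcast (\<lambda>_. 1)"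
  unfolding dominating_broadcast_def
proof
  fix u assume u: "u \<in> verts G"
  have "\<mu> (\<lambda>_. 1) u u \<le> ereal (awalk_cost (\<lambda>_. 1) [])"
    using u by (intro min_cost_le_walk_cost) (simp add: awalk_Nil_iff)
  also have "\<dots> \<le> ereal (real 1)" by simp
  finally show "\<exists>v\<in>verts G. (1::nat) \<le> 1 \<and> \<mu> (\<lambda>_. 1) u v \<le> ereal (real 1)"
    using u by auto
qed

text \<open>The minimum is attained, so \<open>LEAST\<close> is never underspecified here.\<close>

lemma broadcast_number_attained:
  "\<exists>f. dominating_broadcast f \<and> broadcast_cost f = broadcast_number"
  unfolding broadcast_number_def
  by (rule LeastI_ex) (use dominating_broadcast_const_1 in blast)

lemma broadcast_number_le:
  "dominating_broadcast f \<Longrightarrow> broadcast_number \<le> broadcast_cost f"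
  unfolding broadcast_number_def by (rule Least_le) blast

end

text \<open>
  \<open>Rim i\<close> is the cycle vertex \<open>v\<^sub>i\<close> and \<open>Pendant i\<close> the
  pendant vertex \<open>w\<^sub>i\<close>, for \<open>1 \<le> i \<le> n\<close>.
\<close>

datatype sunlet_vertex = Rim nat | Pendant nat

definition sunlet_edges :: "nat \<Rightarrow> sunlet_vertex rel" where
  "sunlet_edges n =
     {(Rim i, Rim (i + 1)) | i. 1 \<le> i \<and> i < n} \<union> {(Rim n, Rim 1)} \<union>
     {(Rim i, Pendant i) | i. 1 \<le> i \<and> i \<le> n}"

text \<open>An undirected edge is represented by the two opposite arcs.\<close>

definition sunlet :: "nat \<Rightarrow> sunlet_vertex pair_pre_digraph" where
  "sunlet n = \<lparr> pverts = Rim ` {1..n} \<union> Pendant ` {1..n},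
                parcs = sunlet_edges n \<union> (sunlet_edges n)\<inverse> \<rparr>"

lemma pair_graph_sunlet:
  assumes "n \<ge> 3"
  shows "pair_graph (sunlet n)"
proof -
  have edges: "sunlet_edges n \<subseteq> pverts (sunlet n) \<times> pverts (sunlet n)"
    using assms by (auto simp: sunlet_edges_def sunlet_def)
  have fin: "finite (pverts (sunlet n))"
    by (simp add: sunlet_def)
  have arcs: "parcs (sunlet n) \<subseteq> pverts (sunlet n) \<times> pverts (sunlet n)"
    using edges by (auto simp: sunlet_def)
  show ?thesis
  proof
    show "finite (parcs (sunlet n))"
      using arcs fin by (meson finite_SigmaI finite_subset)
    show "symmetric (with_proj (sunlet n))"
      by (auto simp: symmetric_def sunlet_def sym_def)
    show "fst e \<noteq> snd e" if "e \<in> parcs (sunlet n)" for e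
      using that assms by (auto simp: sunlet_def sunlet_edges_def)
  qed (use arcs fin in auto)
qed

lemma graph_sunlet: "n \<ge> 3 \<Longrightarrow> graph (with_proj (sunlet n))"
  by (rule pair_graph.pair_graphD_graph) (rule pair_graph_sunlet)

end

theory Submission
  imports Defs "HOL-Number_Theory.Cong"
begin

text \<open>
  A station \<open>v\<close> with \<open>f v = k \<ge> 1\<close> covers at most \<open>2k - 1\<close> pendant vertices, since a nonempty
  walk from a pendant vertex spends its first step on reaching the cycle. Summing over the
  \<open>m \<ge> 1\<close> stations of a dominating broadcast of cost \<open>c\<close> gives \<open>n \<le> 2c - m \<le> 2c - 1\<close>.
  A single station of strength \<open>\<lfloor>n/2\<rfloor> + 1\<close> on the cycle attains this bound.
\<close>

text \<open>Replaces the infimum \<open>\<mu>\<close> by explicit walks, on which both bounds can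
  argue by induction.\<close>

lemma (in wf_digraph) unit_distance_le_iff:
  "\<mu> (\<lambda>_. 1) u v \<le> ereal (real k) \<longleftrightarrow> (\<exists>p. awalk u p v \<and> length p \<le> k)"
proof
  have cost: "awalk_cost (\<lambda>_. 1) p = real (length p)" for p
    by (induction p) auto
  {
    assume "\<exists>p. awalk u p v \<and> length p \<le> k"
    then obtain p where "awalk u p v" "length p \<le> k" by blast
    then show "\<mu> (\<lambda>_. 1) u v \<le> ereal (real k)"
      using min_cost_le_walk_cost[of u p v "\<lambda>_. 1"] by (auto simp: cost intro: order_trans)
  }
  assume le: "\<mu> (\<lambda>_. 1) u v \<le> ereal (real k)"
  show "\<exists>p. awalk u p v \<and> length p \<le> k"
  proof (rule ccontr)
    assume "\<not> ?thesis"
    \<comment> \<open>Lengths are integers, so every walk costs at least k + 1, and so does the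
      infimum; with no walk at all it is infinite.\<close>
    then have "ereal (real (Suc k)) \<le> \<mu> (\<lambda>_. 1) u v"
      unfolding \<mu>_def by (intro INF_greatest) (force simp: cost)
    with le have "ereal (real (Suc k)) \<le> ereal (real k)" by (rule order_trans[rotated])
    then show False by simp
  qed
qed

lemma pverts_sunlet: "pverts (sunlet n) = Rim ` {1..n} \<union> Pendant ` {1..n}"
  by (simp add: sunlet_def)

lemma parcs_sunlet: "parcs (sunlet n) = sunlet_edges n \<union> (sunlet_edges n)\<inverse>"
  by (simp add: sunlet_def)

text \<open>Contracts the pendant edges, so that walks can be followed on the cycle alone.\<close>

fun rim_index :: "sunlet_vertex \<Rightarrow> nat" where
  "rim_index (Rim i) = i"
| "rim_index (Pendant i) = i"

locale sunlet_graph =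
  fixes n :: nat
  assumes n_ge_3: "n \<ge> 3"

sublocale sunlet_graph \<subseteq> graph "with_proj (sunlet n)"
  using n_ge_3 by (rule graph_sunlet)

context sunlet_graph
begin

text \<open>Reading indices modulo n makes the closing edge between \<open>Rim n\<close> and
  \<open>Rim 1\<close> look like any other cycle edge; a pendant edge has offset 0.\<close>

lemma sunlet_arc_offset:
  assumes "(u, v) \<in> parcs (sunlet n)"
  shows "\<exists>d. \<bar>d\<bar> \<le> 1 \<and> [int (rim_index u) = int (rim_index v) + d] (mod int n)"
proof -
  \<comment> \<open>The multiples of n that occur: 0 for ordinary arcs, n and -n for the two
    directions of the closing edge.\<close>
  have dvd: "\<exists>d. \<bar>d\<bar> \<le> 1 \<and> int n dvd int (rim_index u) - (int (rim_index v) + d)"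
    if "int (rim_index u) - (int (rim_index v) + d) \<in> {0, int n, - int n}" "\<bar>d\<bar> \<le> 1" for d
    using that by (intro exI[of _ d]) auto
  consider "rim_index v = rim_index u" | "rim_index v = Suc (rim_index u)"
    | "rim_index u = Suc (rim_index v)" | "rim_index u = n" "rim_index v = 1"
    | "rim_index u = 1" "rim_index v = n"
    using assms by (auto simp: pverts_sunlet parcs_sunlet sunlet_edges_def)
  then show ?thesis
    unfolding cong_iff_dvd_diff
    by cases (rule dvd[of 0] dvd[of 1] dvd[of "-1"]; simp)+
qed

lemma awalk_offset:
  assumes "awalk u p v"
  shows "\<exists>d. \<bar>d\<bar> \<le> int (length p) \<and> [int (rim_index u) = int (rim_index v) + d] (mod int n)"
  using assms
proof (induction p arbitrary: u)
  case Nil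
  then show ?case by (auto simp: awalk_Nil_iff)
next
  case (Cons e p)
  then have arc: "(u, snd e) \<in> parcs (sunlet n)" and walk: "awalk (snd e) p v"
    by (auto simp: awalk_Cons_iff)
  obtain d where d: "\<bar>d\<bar> \<le> 1" "[int (rim_index u) = int (rim_index (snd e)) + d] (mod int n)"
    using sunlet_arc_offset[OF arc] by blast
  obtain d' where d': "\<bar>d'\<bar> \<le> int (length p)"
    "[int (rim_index (snd e)) = int (rim_index v) + d'] (mod int n)"
    using Cons.IH[OF walk] by blast
  have "[int (rim_index u) = int (rim_index v) + d' + d] (mod int n)"
    using d(2) d'(2) by (meson cong_add_rcancel cong_trans)
  with d(1) d'(1) show ?case
    by (intro exI[of _ "d' + d"]) (auto simp: add.assoc)
qed

text \<open>The forced first step leaves the index unchanged, so only k - 1 steps can move it. The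
  empty walk has offset 0, which lies in the interval because k is positive.\<close>

lemma awalk_from_Pendant_offset:
  assumes "awalk (Pendant i) p v" "length p \<le> k" "k \<ge> 1"
  shows "\<exists>d\<in>{- (int k - 1)..int k - 1}. [int i = int (rim_index v) + d] (mod int n)"
proof (cases p)
  case Nil
  with assms show ?thesis by (intro bexI[of _ 0]) (auto simp: awalk_Nil_iff)
next
  case (Cons e q)
  with assms(1) have arc: "(Pendant i, snd e) \<in> parcs (sunlet n)" and walk: "awalk (snd e) q v"
    by (auto simp: awalk_Cons_iff)
  from arc have "snd e = Rim i"
    by (auto simp: pverts_sunlet parcs_sunlet sunlet_edges_def)
  with awalk_offset[OF walk] Cons assms(2) show ?thesis
    by force
qed

definition covered_pendants :: "sunlet_vertex \<Rightarrow> nat \<Rightarrow> nat set" where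
  "covered_pendants v k = {i \<in> {1..n}. \<mu> (\<lambda>_. 1) (Pendant i) v \<le> ereal (real k)}"

lemma card_covered_pendants:
  assumes "k \<ge> 1"
  shows "card (covered_pendants v k) \<le> 2 * k - 1"
proof -
  let ?D = "{- (int k - 1)..int k - 1}"
  \<comment> \<open>The representative in {1..n} of the index shifted by d; subtracting 1 before
    \<open>mod\<close> and adding it afterwards yields n instead of 0.\<close>
  let ?g = "\<lambda>d. nat ((int (rim_index v) + d - 1) mod int n + 1)"
  have "covered_pendants v k \<subseteq> ?g ` ?D"
  proof
    fix i assume "i \<in> covered_pendants v k"
    then have i: "1 \<le> i" "i \<le> n" and "\<exists>p. awalk (Pendant i) p v \<and> length p \<le> k"
      unfolding covered_pendants_def unit_distance_le_iff by auto
    then obtain d where d: "d \<in> ?D" "[int i = int (rim_index v) + d] (mod int n)"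
      using awalk_from_Pendant_offset assms by blast
    have "[int i - 1 = int (rim_index v) + d - 1] (mod int n)"
      using d(2) by (intro cong_diff) auto
    moreover have "(int i - 1) mod int n = int i - 1"
      using i by (intro mod_pos_pos_trivial) auto
    ultimately have "(int (rim_index v) + d - 1) mod int n = int i - 1"
      by (simp add: cong_def)
    then have "i = ?g d" by simp
    with d(1) show "i \<in> ?g ` ?D" by blast
  qed
  then have "card (covered_pendants v k) \<le> card ?D"
    by (rule surj_card_le[rotated]) simp
  also have "\<dots> = 2 * k - 1"
    using assms by simp
  finally show ?thesis .
qed

lemma dominating_broadcast_cost_ge:
  assumes "dominating_broadcast f"
  shows "n + 1 \<le> 2 * broadcast_cost f"
proof -
  define V where "V = pverts (sunlet n)"
  define S where "S = {v \<in> V. f v \<ge> 1}"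
  have "finite V" by (simp add: V_def pverts_sunlet)
  then have "finite S" by (simp add: S_def)
  have "{1..n} \<subseteq> (\<Union>v\<in>S. covered_pendants v (f v))"
  proof
    fix i assume i: "i \<in> {1..n}"
    then have "Pendant i \<in> verts (with_proj (sunlet n))" by (simp add: pverts_sunlet)
    with i assms show "i \<in> (\<Union>v\<in>S. covered_pendants v (f v))"
      by (fastforce simp: dominating_broadcast_def covered_pendants_def S_def V_def)
  qed
  then have "card {1..n} \<le> card (\<Union>v\<in>S. covered_pendants v (f v))"
    using \<open>finite S\<close> by (intro card_mono) (auto simp: covered_pendants_def)
  also have "\<dots> \<le> (\<Sum>v\<in>S. card (covered_pendants v (f v)))"
    using \<open>finite S\<close> by (rule card_UN_le)
  also have "\<dots> \<le> (\<Sum>v\<in>S. 2 * f v - 1)"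
    by (intro sum_mono card_covered_pendants) (simp add: S_def)
  finally have n_le: "n \<le> (\<Sum>v\<in>S. 2 * f v - 1)" by simp
  \<comment> \<open>Giving back 1 per station cancels the natural-number subtraction, which does not
    truncate since \<open>f v\<close> is positive on \<open>S\<close>.\<close>
  have "(\<Sum>v\<in>S. 2 * f v - 1) + card S = (\<Sum>v\<in>S. (2 * f v - 1) + 1)"
    by (simp add: sum.distrib del: One_nat_def)
  also have "\<dots> = (\<Sum>v\<in>S. 2 * f v)"
    by (intro sum.cong) (auto simp: S_def)
  also have "\<dots> \<le> 2 * (\<Sum>v\<in>V. f v)"
    unfolding sum_distrib_left using \<open>finite V\<close> by (intro sum_mono2) (auto simp: S_def)
  finally have "(\<Sum>v\<in>S. 2 * f v - 1) + card S \<le> 2 * broadcast_cost f"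
    by (simp add: broadcast_cost_def V_def)
  \<comment> \<open>An empty sum would force n = 0. This one station supplies the + 1 in the
    bound.\<close>
  moreover have "S \<noteq> {}"
    using n_le n_ge_3 by auto
  then have "card S \<ge> 1"
    using \<open>finite S\<close> by (simp add: Suc_le_eq card_gt_0_iff)
  ultimately show ?thesis using n_le by linarith
qed

lemma awalk_down_to_Rim_1:
  assumes "i < n"
  shows "\<exists>p. awalk (Rim (Suc i)) p (Rim 1) \<and> length p = i"
  using assms
proof (induction i)
  case 0
  then show ?case by (auto simp: awalk_Nil_iff pverts_sunlet)
next
  case (Suc i)
  then obtain p where "awalk (Rim (Suc i)) p (Rim 1)" "length p = i" by auto
  with Suc.prems show ?case
    by (intro exI[of _ "(Rim (Suc (Suc i)), Rim (Suc i)) # p"])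
       (auto simp: awalk_Cons_iff pverts_sunlet parcs_sunlet sunlet_edges_def)
qed

text \<open>Counting down from n makes the closing arc the base case; that arc accounts for the
  \<open>Suc\<close> in the length.\<close>

lemma awalk_up_to_Rim_1:
  assumes "i < n"
  shows "\<exists>p. awalk (Rim (n - i)) p (Rim 1) \<and> length p = Suc i"
  using assms
proof (induction i)
  case 0
  then show ?case
    by (intro exI[of _ "[(Rim n, Rim 1)]"])
       (auto simp: awalk_Cons_iff awalk_Nil_iff pverts_sunlet parcs_sunlet sunlet_edges_def)
next
  case (Suc i)
  then obtain p where "awalk (Rim (n - i)) p (Rim 1)" "length p = Suc i" by auto
  moreover have "n - i = Suc (n - Suc i)" using Suc.prems by simp
  ultimately show ?case using Suc.prems
    by (intro exI[of _ "(Rim (n - Suc i), Rim (n - i)) # p"])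
       (auto simp: awalk_Cons_iff pverts_sunlet parcs_sunlet sunlet_edges_def)
qed

lemma awalk_Rim_to_Rim_1:
  assumes "1 \<le> i" "i \<le> n"
  shows "\<exists>p. awalk (Rim i) p (Rim 1) \<and> length p \<le> n div 2"
\<comment> \<open>\<open>Rim 1\<close> is i - 1 steps away downwards and n - i + 1 steps upwards;
  the downward route fits into \<open>n div 2\<close> exactly in the first case, the upward one fits
  in the other.\<close>
proof (cases "i \<le> n div 2 + 1")
  case True
  with assms awalk_down_to_Rim_1[of "i - 1"] show ?thesis by fastforce
next
  case False
  then have "Suc (n - i) \<le> n div 2" using assms by linarith
  with assms awalk_up_to_Rim_1[of "n - i"] show ?thesis by fastforce
qed

text \<open>At most \<open>n div 2\<close> steps along the cycle, plus one for a pendant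
  edge.\<close>

lemma eccentricity_Rim_1:
  assumes "u \<in> pverts (sunlet n)"
  shows "\<mu> (\<lambda>_. 1) u (Rim 1) \<le> ereal (real (n div 2 + 1))"
proof -
  have "1 \<le> rim_index u" "rim_index u \<le> n"
    using assms by (auto simp: pverts_sunlet)
  then obtain p where p: "awalk (Rim (rim_index u)) p (Rim 1)" "length p \<le> n div 2"
    using awalk_Rim_to_Rim_1 by blast
  show ?thesis
  proof (cases u)
    case (Rim i)
    with p show ?thesis unfolding unit_distance_le_iff by (intro exI[of _ p]) auto
  next
    case (Pendant i)
    with p assms show ?thesis unfolding unit_distance_le_iff
      by (intro exI[of _ "(Pendant i, Rim i) # p"])
         (auto simp: awalk_Cons_iff pverts_sunlet parcs_sunlet sunlet_edges_def)
  qed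
qed

lemma broadcast_number_sunlet: "broadcast_number = n div 2 + 1"
proof (rule antisym)
  let ?f = "\<lambda>v. if v = Rim 1 then n div 2 + 1 else 0"
  have Rim_1: "Rim 1 \<in> pverts (sunlet n)" using n_ge_3 by (auto simp: pverts_sunlet)
  have "dominating_broadcast ?f"
    unfolding dominating_broadcast_def using eccentricity_Rim_1 Rim_1
    by (auto intro!: bexI[of _ "Rim 1"])
  moreover have "finite (pverts (sunlet n))" by (simp add: pverts_sunlet)
  then have "broadcast_cost ?f = n div 2 + 1"
    using Rim_1 by (simp add: broadcast_cost_def sum.delta del: One_nat_def)
  ultimately show "broadcast_number \<le> n div 2 + 1"
    using broadcast_number_le by metis
  obtain f where "dominating_broadcast f" "broadcast_cost f = broadcast_number"
    using broadcast_number_attained by blast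
  with dominating_broadcast_cost_ge[of f] show "n div 2 + 1 \<le> broadcast_number"
    by linarith
qed

end

theorem theorem2:
  fixes n :: nat
  assumes "n \<ge> 3"
  shows "int (graph.broadcast_number (with_proj (sunlet n))) = \<lceil>(real n + 1) / 2\<rceil>"
proof -
  interpret sunlet_graph n by unfold_locales (rule assms)
  \<comment> \<open>With r = n mod 2, the argument of the ceiling is \<open>n div 2\<close> + (r +
    1)/2, and (r + 1)/2 is 1/2 or 1, so both parities round up to
    \<open>n div 2 + 1\<close>.\<close>
  have "real n = 2 * real (n div 2) + real (n mod 2)"
    by (metis of_nat_add of_nat_mult of_nat_numeral mult_div_mod_eq)
  moreover have "n mod 2 < 2" by simp
  ultimately have "\<lceil>(real n + 1) / 2\<rceil> = int (n div 2 + 1)"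
    by (intro ceiling_unique) (auto simp: less_2_cases_iff)
  then show ?thesis by (simp only: broadcast_number_sunlet)
qed

end
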